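(* The image of any ruling of $\mathcal M_0$ under the map $E$ is also a ruling of $\mathcal A_0$.
   Context: $\mathcal M_0=\{(e^{i\theta},xe^{i\theta/2}):0\le\theta<2\pi,\ -2<x<2\}$ (a Möbius strip without its boundary), regarded as a subset of the plane at infinity of $\mathbb P^3(\mathbb C)$ by $(\xi,\eta)\mapsto(\xi:\eta:1:0)$. Its rulings are the segments with $\theta$ fixed. $R_3=\{(z_1,z_2,\bar z_1):z_1\in\mathbb C,\ z_2\in\mathbb R\}$ is identified with $\mathbb R^3$ via $(p_1,p_2,q)$, where $z_1=p_1+ip_2$, $z_2=q$; points of $R_3$ are written $(z_1,z_2)$. In the coordinates $(p_1,p_2,q)$, $$\mathcal A_0=\{(4\cos^3u,4\sin^3u,6\cos2u)+v(\cos u,-\sin u,2):0\le u<2\pi,\ -2-2\cos2u<v<2-2\cos2u\}.$$ Its rulings are the segments with $u$ fixed. For $t_1,t_2,t_3\in\mathbb C\setminus\{0\}$ let $\Phi_1(t_1,t_2,t_3)$ be the triple of the first three elementary symmetric functions of $t_1,t_2,t_3,1/(t_1t_2t_3)$. The external ray $R(\alpha,\beta,\alpha)=\{\Phi_1(re^{i\alpha},e^{i\beta},\frac1re^{i\alpha}):r>1\}$ is a half-line in $R_3$. When $\alpha+\beta\ne0,\pi$, it has two end points, one ($r\to\infty$) in $\mathcal M_0$ and the other ($r=1$) in $\mathcal A_0$. Using these two end points, the map $E$ from $\mathcal M_0$ to $\mathcal A_0$ is defined by $$E\big((e^{2i\alpha}:2\cos(\alpha+\beta)e^{i\alpha}:1:0)\big)=\big(2e^{i\alpha}+e^{i\beta}+e^{i(-2\alpha-\beta)},\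 4\cos(\alpha+\beta)+2\cos2\alpha\big).$$ *)

theory Defs
  imports "HOL-Analysis.Analysis"
begin

section \<open>The projective space and its plane at infinity\<close>

definition proj_rel :: "complex^4 \<Rightarrow> complex^4 \<Rightarrow> bool" where
  "proj_rel v w \<longleftrightarrow> v \<noteq> 0 \<and> w \<noteq> 0 \<and> (\<exists>c. c \<noteq> 0 \<and> w = c *s v)"

lemma part_equivp_proj_rel: "part_equivp proj_rel"
proof (rule part_equivpI)
  have "proj_rel 1 1"
    unfolding proj_rel_def by (auto intro: exI[of _ 1])
  then show "\<exists>v. proj_rel v v" by blast
  show "symp proj_rel"
  proof (rule sympI)
    fix v w assume "proj_rel v w"
    then obtain c where c: "v \<noteq> 0" "w \<noteq> 0" "c \<noteq> 0" "w = c *s v"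
      unfolding proj_rel_def by blast
    then have "v = inverse c *s w" by (simp add: vec_eq_iff)
    with c show "proj_rel w v"
      unfolding proj_rel_def by (metis nonzero_imp_inverse_nonzero)
  qed
  show "transp proj_rel"
  proof (rule transpI)
    fix u v w assume "proj_rel u v" "proj_rel v w"
    then obtain c d where "u \<noteq> 0" "w \<noteq> 0" "c \<noteq> 0" "v = c *s u" "d \<noteq> 0" "w = d *s v"
      unfolding proj_rel_def by blast
    then show "proj_rel u w"
      unfolding proj_rel_def by (auto intro!: exI[of _ "d * c"])
  qed
qed

quotient_type P3 = "complex^4" / partial: proj_rel
  by (rule part_equivp_proj_rel)

lemma vector_4:
  "(vector [w, x, y, z] :: 'a::zero^4) $ 1 = w"
  "(vector [w, x, y, z] :: 'a::zero^4) $ 2 = x"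
  "(vector [w, x, y, z] :: 'a::zero^4) $ 3 = y"
  "(vector [w, x, y, z] :: 'a::zero^4) $ 4 = z"
  unfolding vector_def by simp_all

lemma vector_4_1_0_nonzero: "(vector [\<xi>, \<eta>, 1, 0] :: complex^4) \<noteq> 0"
proof
  assume "(vector [\<xi>, \<eta>, 1, 0] :: complex^4) = 0"
  then have "(vector [\<xi>, \<eta>, 1, 0] :: complex^4) $ 3 = 0" by simp
  then show False by (simp add: vector_4)
qed

lift_definition inf_point :: "complex \<Rightarrow> complex \<Rightarrow> P3" is
  "\<lambda>\<xi> \<eta>. vector [\<xi>, \<eta>, 1, 0]"
  by (auto simp: proj_rel_def vector_4_1_0_nonzero intro!: exI[of _ 1])

lemma inf_point_eq_iff: "inf_point \<xi> \<eta> = inf_point \<xi>' \<eta>' \<longleftrightarrow> \<xi> = \<xi>' \<and> \<eta> = \<eta>'"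
proof
  assume "inf_point \<xi> \<eta> = inf_point \<xi>' \<eta>'"
  then have "proj_rel (vector [\<xi>, \<eta>, 1, 0]) (vector [\<xi>', \<eta>', 1, 0])"
    by transfer
  then obtain c where "(vector [\<xi>', \<eta>', 1, 0] :: complex^4) = c *s vector [\<xi>, \<eta>, 1, 0]"
    unfolding proj_rel_def by blast
  then have "\<forall>i. (vector [\<xi>', \<eta>', 1, 0] :: complex^4) $ i = c * (vector [\<xi>, \<eta>, 1, 0] :: complex^4) $ i"
    by (simp add: vec_eq_iff)
  then show "\<xi> = \<xi>' \<and> \<eta> = \<eta>'" by (simp add: forall_4 vector_4)
qed simp

section \<open>The open Moebius strip at infinity\<close>

definition M0_ruling :: "real \<Rightarrow> P3 set" where
  "M0_ruling \<theta> = {inf_point (cis \<theta>) (of_real x * cis (\<theta> / 2)) | x. -2 < x \<and> x < 2}"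

definition M0 :: "P3 set" where
  "M0 = (\<Union>\<theta>\<in>{0..<2*pi}. M0_ruling \<theta>)"

definition M0_rulings :: "P3 set set" where
  "M0_rulings = M0_ruling ` {0..<2*pi}"

section \<open>The real slice and the ruled surface in it\<close>

text \<open>\<open>R3_point z q\<close> is the point of the slice that is abbreviated \<open>(z, q)\<close>.\<close>

definition R3_point :: "complex \<Rightarrow> real \<Rightarrow> complex^3" where
  "R3_point z q = vector [z, of_real q, cnj z]"

definition R3 :: "(complex^3) set" where
  "R3 = {R3_point z q | z q. True}"

definition R3_of_coords :: "real^3 \<Rightarrow> complex^3" where
  "R3_of_coords p = R3_point (Complex (p $ 1) (p $ 2)) (p $ 3)"

definition A0_ruling :: "real \<Rightarrow> (complex^3) set" where
  "A0_ruling u = R3_of_coords `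
     {vector [4 * cos u ^ 3, 4 * sin u ^ 3, 6 * cos (2 * u)] + v *\<^sub>R vector [cos u, - sin u, 2] | v.
       -2 - 2 * cos (2 * u) < v \<and> v < 2 - 2 * cos (2 * u)}"

definition A0 :: "(complex^3) set" where
  "A0 = (\<Union>u\<in>{0..<2*pi}. A0_ruling u)"

definition A0_rulings :: "(complex^3) set set" where
  "A0_rulings = A0_ruling ` {0..<2*pi}"

section \<open>The map from the strip to the surface\<close>

text \<open>
  A point of the strip determines the angle \<open>\<alpha>\<close> only modulo \<open>pi\<close>: replacing \<open>\<alpha>\<close>
  by \<open>\<alpha> + pi\<close> does not change \<open>(cis (2\<alpha>) : 2 cos (\<alpha> + \<beta>) cis \<alpha> : 1 : 0)\<close>, but it replaces
  the external ray by one with opposite direction, whose finite end point is different.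
  So the defining formula of \<open>E\<close> gives a function only once \<open>\<alpha>\<close> is restricted to a half-open
  interval \<open>[a, a + pi)\<close>. The start \<open>a\<close> is kept as a parameter; \<open>a = 0\<close> corresponds to
  \<open>\<alpha> = \<theta> / 2\<close> for \<open>0 \<le> \<theta> < 2 pi\<close>.
\<close>

definition E_graph :: "real \<Rightarrow> P3 \<Rightarrow> complex^3 \<Rightarrow> bool" where
  "E_graph a P w \<longleftrightarrow> (\<exists>\<alpha> \<beta>. a \<le> \<alpha> \<and> \<alpha> < a + pi \<and>
     P = inf_point (cis (2 * \<alpha>)) (of_real (2 * cos (\<alpha> + \<beta>)) * cis \<alpha>) \<and>
     w = R3_point (2 * cis \<alpha> + cis \<beta> + cis (- 2 * \<alpha> - \<beta>))
           (4 * cos (\<alpha> + \<beta>) + 2 * cos (2 * \<alpha>)))"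

definition E :: "real \<Rightarrow> P3 \<Rightarrow> complex^3" where
  "E a P = (THE w. E_graph a P w)"

lemma cis_2_window_inj:
  assumes "cis (2 * \<alpha>) = cis (2 * \<alpha>')" "a \<le> \<alpha>" "\<alpha> < a + pi" "a \<le> \<alpha>'" "\<alpha>' < a + pi"
  shows "\<alpha> = \<alpha>'"
proof -
  from assms(1) have "cos (2*\<alpha>) = cos (2*\<alpha>') \<and> sin (2*\<alpha>) = sin (2*\<alpha>')"
    by (metis cis.sel)
  then obtain n :: int where n: "2*\<alpha> = 2*\<alpha>' + 2 * pi * n"
    using sin_cos_eq_iff by metis
  then have "\<alpha> - \<alpha>' = pi * n" by simp
  with assms have "pi * of_int n < pi * 1" "pi * (- 1) < pi * of_int n" by linarith+
  then have "real_of_int n < 1" "- 1 < real_of_int n"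
    by (simp_all only: mult_less_cancel_left_pos[OF pi_gt_zero])
  then have "n = 0" by linarith
  with n show ?thesis by simp
qed

lemma E_first_coord:
  "2 * cis \<alpha> + cis \<beta> + cis (- 2 * \<alpha> - \<beta>) = 2 * cis \<alpha> + of_real (2 * cos (\<alpha> + \<beta>)) * cis (- \<alpha>)"
proof -
  have "complex_of_real (2 * cos (\<alpha> + \<beta>)) = cis (\<alpha> + \<beta>) + cis (- (\<alpha> + \<beta>))"
    using cos_minus[of "\<alpha> + \<beta>"] sin_minus[of "\<alpha> + \<beta>"]
    by (simp add: complex_eq_iff del: minus_add_distrib)
  then have "complex_of_real (2 * cos (\<alpha> + \<beta>)) * cis (- \<alpha>) = cis \<beta> + cis (- 2 * \<alpha> - \<beta>)"
    by (simp add: distrib_right cis_mult algebra_simps)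
  then show ?thesis by simp
qed

lemma E_graph_unique:
  assumes "E_graph a P w" "E_graph a P w'"
  shows "w = w'"
proof -
  from assms obtain \<alpha> \<beta> \<alpha>' \<beta>' where
    a: "a \<le> \<alpha>" "\<alpha> < a + pi" "a \<le> \<alpha>'" "\<alpha>' < a + pi" and
    P: "P = inf_point (cis (2 * \<alpha>)) (of_real (2 * cos (\<alpha> + \<beta>)) * cis \<alpha>)"
       "P = inf_point (cis (2 * \<alpha>')) (of_real (2 * cos (\<alpha>' + \<beta>')) * cis \<alpha>')" and
    w: "w = R3_point (2 * cis \<alpha> + cis \<beta> + cis (- 2 * \<alpha> - \<beta>)) (4 * cos (\<alpha> + \<beta>) + 2 * cos (2 * \<alpha>))"
       "w' = R3_point (2 * cis \<alpha>' + cis \<beta>' + cis (- 2 * \<alpha>' - \<beta>')) (4 * cos (\<alpha>' + \<beta>') + 2 * cos (2 * \<alpha>'))"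
    unfolding E_graph_def by blast
  have eq: "\<alpha>' = \<alpha>"
    using P a cis_2_window_inj[of \<alpha> \<alpha>' a] by (simp add: inf_point_eq_iff)
  with P have "complex_of_real (2 * cos (\<alpha> + \<beta>)) = of_real (2 * cos (\<alpha> + \<beta>'))"
    by (simp add: inf_point_eq_iff del: of_real_mult)
  then have "cos (\<alpha> + \<beta>) = cos (\<alpha> + \<beta>')" by (simp only: of_real_eq_iff)
  with w eq show ?thesis by (simp only: E_first_coord)
qed

lemma E_eq:
  assumes "a \<le> \<alpha>" "\<alpha> < a + pi"
  shows "E a (inf_point (cis (2 * \<alpha>)) (of_real (2 * cos (\<alpha> + \<beta>)) * cis \<alpha>)) =
    R3_point (2 * cis \<alpha> + cis \<beta> + cis (- 2 * \<alpha> - \<beta>)) (4 * cos (\<alpha> + \<beta>) + 2 * cos (2 * \<alpha>))"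
proof -
  have graph: "E_graph a (inf_point (cis (2 * \<alpha>)) (of_real (2 * cos (\<alpha> + \<beta>)) * cis \<alpha>))
    (R3_point (2 * cis \<alpha> + cis \<beta> + cis (- 2 * \<alpha> - \<beta>)) (4 * cos (\<alpha> + \<beta>) + 2 * cos (2 * \<alpha>)))"
    unfolding E_graph_def using assms by blast
  show ?thesis
    unfolding E_def by (rule the_equality) (use graph E_graph_unique in blast)+
qed

end

theory Submission
  imports Defs
begin

text \<open>
  Put \<open>x = 2 cos (\<alpha> + \<beta>)\<close>. As \<open>\<beta>\<close> varies, the point of the strip with angle \<open>\<alpha>\<close> is
  \<open>(cis (2\<alpha>) : x cis \<alpha> : 1 : 0)\<close> and its image is \<open>(2 cis \<alpha> + x cis (-\<alpha>), 2x + 2 cos (2\<alpha>))\<close>,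
  which is affine in \<open>x\<close>. So \<open>x\<close> is a common parameter on both sides: the first formula describes the
  ruling of the strip with \<open>\<theta> = 2\<alpha>\<close>, and the second, after the shift \<open>x = v + 2 cos (2u)\<close>
  (lemma \<open>A0_ruling_eq\<close>), describes the ruling of the surface with \<open>u = \<alpha>\<close>. Both segments are given by
  \<open>-2 < x < 2\<close>, so \<open>E\<close> carries the first onto the second (lemma \<open>E_image_M0_ruling\<close>).

  What remains is to match the windows of the angles. The ruling of the strip depends only on \<open>\<theta>\<close>
  modulo \<open>2 pi\<close>, because adding \<open>2 pi\<close> changes the sign of \<open>cis (\<theta> / 2)\<close> and the
  interval \<open>-2 < x < 2\<close> is symmetric; hence \<open>\<alpha>\<close> can be moved into the window \<open>[a, a + pi)\<close> on which
  \<open>E a\<close> is defined by the formula. The resulting \<open>u = \<alpha>\<close> is only known modulo \<open>2 pi\<close>, which does not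
  affect the ruling of the surface. Different choices of \<open>a\<close> may send the same ruling of the strip to
  the rulings with \<open>u = \<alpha>\<close> or \<open>u = \<alpha> + pi\<close>.
\<close>

text \<open>
  The substitution is \<open>x = v + 2 cos (2u)\<close>. It turns
  \<open>4 cos u ^ 3 + v cos u\<close> into \<open>(2 + x) cos u\<close> and \<open>4 sin u ^ 3 - v sin u\<close> into
  \<open>(2 - x) sin u\<close>, which are the real and imaginary parts of \<open>2 cis u + x cis (-u)\<close>.
\<close>
lemma A0_ruling_eq:
  "A0_ruling u =
    (\<lambda>x. R3_point (2 * cis u + of_real x * cis (- u)) (2 * x + 2 * cos (2 * u))) ` {-2<..<2}"
proof -
  define g where
    "g x = R3_point (2 * cis u + of_real x * cis (- u)) (2 * x + 2 * cos (2 * u))" for x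
  have coords: "R3_of_coords (vector [4 * cos u ^ 3, 4 * sin u ^ 3, 6 * cos (2 * u)] +
      v *\<^sub>R vector [cos u, - sin u, 2]) = g (v + 2 * cos (2 * u))" for v
  proof -
    have re: "4 * cos u ^ 3 + v * cos u = 2 * cos u + (v + 2 * cos (2 * u)) * cos u"
      unfolding cos_double_cos by (simp add: algebra_simps power2_eq_square power3_eq_cube)
    have im: "4 * sin u ^ 3 - v * sin u = 2 * sin u - (v + 2 * cos (2 * u)) * sin u"
      unfolding cos_double_sin by (simp add: algebra_simps power2_eq_square power3_eq_cube)
    have "Complex (4 * cos u ^ 3 + v * cos u) (4 * sin u ^ 3 - v * sin u) =
        2 * cis u + of_real (v + 2 * cos (2 * u)) * cis (- u)"
      by (simp add: complex_eq_iff re im del: of_real_add of_real_mult)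
    then show ?thesis
      unfolding g_def R3_of_coords_def by (simp add: vector_3 algebra_simps)
  qed
  have shift: "(\<lambda>v. v + 2 * cos (2 * u)) ` {-2 - 2 * cos (2 * u)<..<2 - 2 * cos (2 * u)} = {-2<..<2}"
  proof -
    have "x \<in> (\<lambda>v. v + 2 * cos (2 * u)) ` {-2 - 2 * cos (2 * u)<..<2 - 2 * cos (2 * u)}"
      if "x \<in> {-2<..<2}" for x
      using that by (intro image_eqI[of _ _ "x - 2 * cos (2 * u)"]) auto
    then show ?thesis by auto
  qed
  have "A0_ruling u =
      (\<lambda>v. g (v + 2 * cos (2 * u))) ` {-2 - 2 * cos (2 * u)<..<2 - 2 * cos (2 * u)}"
    unfolding A0_ruling_def coords[symmetric] setcompr_eq_image image_image
    by (intro image_cong) auto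
  also have "\<dots> = g ` {-2<..<2}"
    unfolding shift[symmetric] by (simp only: image_image)
  finally show ?thesis unfolding g_def .
qed

text \<open>
  The parametrization in \<open>A0_ruling_eq\<close> involves \<open>u\<close> only through \<open>cos u\<close> and \<open>sin u\<close>.
\<close>
lemma A0_ruling_cong:
  assumes "cis u = cis u'"
  shows "A0_ruling u = A0_ruling u'"
proof -
  have "cos u = cos u'" "sin u = sin u'"
    using assms by (metis cis.sel)+
  then have "cis (- u) = cis (- u')" "cos (2 * u) = cos (2 * u')"
    by (simp_all add: complex_eq_iff cos_double)
  then show ?thesis
    unfolding A0_ruling_eq assms by simp
qed

lemma angle_representative:
  fixes t p b :: real
  assumes "p > 0"
  obtains n :: int where "b \<le> t + of_int n * p" "t + of_int n * p < b + p"
proof -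
  define m where "m = \<lfloor>(t - b) / p\<rfloor>"
  have "of_int m \<le> (t - b) / p" "(t - b) / p < of_int m + 1"
    unfolding m_def by linarith+
  then have "of_int m * p \<le> t - b" "t - b < (of_int m + 1) * p"
    using assms by (simp_all add: field_simps)
  then show thesis
    by (intro that[of "- m"]) (simp_all add: algebra_simps)
qed

lemma A0_ruling_in_A0_rulings: "A0_ruling u \<in> A0_rulings"
proof -
  obtain n :: int where n: "0 \<le> u + of_int n * (2 * pi)" "u + of_int n * (2 * pi) < 0 + 2 * pi"
    using angle_representative[of "2 * pi"] by (metis pi_gt_zero mult_pos_pos zero_less_numeral)
  have "cis (of_int n * (2 * pi)) = 1"
    using cis_multiple_2pi[of "of_int n"] by (simp add: mult.commute mult.left_commute)
  then have "cis u = cis (u + of_int n * (2 * pi))"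
    by (simp flip: cis_mult)
  then have "A0_ruling u = A0_ruling (u + of_int n * (2 * pi))"
    by (rule A0_ruling_cong)
  then show ?thesis
    unfolding A0_rulings_def using n by auto
qed

text \<open>
  The two angles \<open>\<alpha>\<close> and \<open>\<theta> / 2\<close> agree up to a multiple of \<open>pi\<close>, so that
  \<open>cis \<alpha>\<close> and \<open>cis (\<theta> / 2)\<close> agree up to sign; the sign is absorbed by \<open>x \<mapsto> -x\<close>.
\<close>
lemma M0_ruling_eq:
  assumes "\<alpha> = \<theta> / 2 + of_int n * pi"
  shows "M0_ruling \<theta> = (\<lambda>x. inf_point (cis (2 * \<alpha>)) (of_real x * cis \<alpha>)) ` {-2<..<2}"
proof -
  have "2 * \<alpha> = \<theta> + 2 * pi * of_int n"
    using assms by simp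
  then have dbl: "cis (2 * \<alpha>) = cis \<theta>"
    by (simp flip: cis_mult)
  have "cis \<alpha> ^ 2 = cis (\<theta> / 2) ^ 2"
    using dbl by (simp add: power2_eq_square cis_mult)
  then consider "cis \<alpha> = cis (\<theta> / 2)" | "cis \<alpha> = - cis (\<theta> / 2)"
    by (auto simp: power2_eq_iff)
  then show ?thesis
  proof cases
    case 1
    then show ?thesis
      unfolding M0_ruling_def dbl by auto
  next
    case 2
    have "(\<lambda>x. inf_point (cis \<theta>) (of_real x * cis \<alpha>)) ` {-2<..<2} =
        (\<lambda>x. inf_point (cis \<theta>) (of_real x * cis (\<theta> / 2))) ` uminus ` {-2<..<2}"
      unfolding image_image 2 by simp
    also have "uminus ` {-2<..<2} = {-2<..<2::real}"
      by simp
    finally show ?thesis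
      unfolding M0_ruling_def dbl by auto
  qed
qed

text \<open>Any \<open>x\<close> with \<open>-2 \<le> x \<le> 2\<close> is \<open>2 cos (\<alpha> + \<beta>)\<close> for some \<open>\<beta>\<close>.\<close>
lemma E_inf_point:
  assumes "a \<le> \<alpha>" "\<alpha> < a + pi" "-2 \<le> x" "x \<le> 2"
  shows "E a (inf_point (cis (2 * \<alpha>)) (of_real x * cis \<alpha>)) =
    R3_point (2 * cis \<alpha> + of_real x * cis (- \<alpha>)) (2 * x + 2 * cos (2 * \<alpha>))"
proof -
  define \<beta> where "\<beta> = arccos (x / 2) - \<alpha>"
  have x: "2 * cos (\<alpha> + \<beta>) = x"
    using assms by (simp add: \<beta>_def)
  have x2: "4 * cos (\<alpha> + \<beta>) = 2 * x"
    using x by simp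
  show ?thesis
    using E_eq[OF assms(1,2), of \<beta>] unfolding E_first_coord x x2 .
qed

lemma E_image_M0_ruling:
  assumes "\<alpha> = \<theta> / 2 + of_int n * pi" "a \<le> \<alpha>" "\<alpha> < a + pi"
  shows "E a ` M0_ruling \<theta> = A0_ruling \<alpha>"
  unfolding M0_ruling_eq[OF assms(1)] A0_ruling_eq image_image
  using assms(2,3) by (intro image_cong refl E_inf_point) auto

theorem proposition4p9:
  fixes a :: real and L :: "P3 set"
  assumes "L \<in> M0_rulings"
  shows "E a ` L \<in> A0_rulings"
proof -
  obtain \<theta> where L: "L = M0_ruling \<theta>"
    using assms unfolding M0_rulings_def by blast
  obtain n :: int where "a \<le> \<theta> / 2 + of_int n * pi" "\<theta> / 2 + of_int n * pi < a + pi"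
    using angle_representative[OF pi_gt_zero] .
  then have "E a ` L = A0_ruling (\<theta> / 2 + of_int n * pi)"
    unfolding L by (rule E_image_M0_ruling[OF refl])
  then show ?thesis
    by (simp only: A0_ruling_in_A0_rulings)
qed

end
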